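(* Let $F$ be a field, $p$ a prime number, and $A$ a central simple $F$-algebra of degree $p$ with a maximal subfield $K$. Suppose that there is an extension $E'$ of $K$ such that $E'/F$ is Galois with finite group $G=C_p\rtimes H$ and $(E')^H=K$. Then there is a subfield $E\subset E'$ containing $K$ such that $E/F$ is Galois with group $C_p\rtimes C_m$ for some $m$, where $C_m$ acts faithfully on $C_p$.
   Context: $C_k$ denotes the cyclic group of order $k$. In $C_p\rtimes H$ the subgroup $C_p$ is normal, and $H$ acts on it by conjugation. *)

theory Defs
  imports "HOL-Algebra.Algebra"
begin

section \<open>Central simple algebras\<close>

text \<open>An algebra over a field is given as a ring together with the (embedded) base field,
  as in \<^theory>\<open>HOL-Algebra.Embedded_Algebras\<close>.\<close>

definition ring_center :: "('a, 'r) ring_scheme \<Rightarrow> 'a set"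
  where "ring_center R = {x \<in> carrier R. \<forall>y \<in> carrier R. x \<otimes>\<^bsub>R\<^esub> y = y \<otimes>\<^bsub>R\<^esub> x}"

definition simple_ring :: "('a, 'r) ring_scheme \<Rightarrow> bool"
  where "simple_ring R \<longleftrightarrow>
    ring R \<and> \<one>\<^bsub>R\<^esub> \<noteq> \<zero>\<^bsub>R\<^esub> \<and> (\<forall>I. ideal I R \<longrightarrow> I = {\<zero>\<^bsub>R\<^esub>} \<or> I = carrier R)"

definition central_simple_algebra :: "'a set \<Rightarrow> ('a, 'r) ring_scheme \<Rightarrow> bool"
  where "central_simple_algebra F A \<longleftrightarrow>
    simple_ring A \<and> subfield F A \<and> ring_center A = F \<and> (\<exists>d. ring.dimension A d F (carrier A))"

text \<open>The degree of a central simple algebra is the square root of its dimension.\<close>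

definition has_degree :: "'a set \<Rightarrow> ('a, 'r) ring_scheme \<Rightarrow> nat \<Rightarrow> bool"
  where "has_degree F A n \<longleftrightarrow> ring.dimension A (n\<^sup>2) F (carrier A)"

definition maximal_subfield :: "'a set \<Rightarrow> 'a set \<Rightarrow> ('a, 'r) ring_scheme \<Rightarrow> bool"
  where "maximal_subfield K F A \<longleftrightarrow>
    subfield K A \<and> F \<subseteq> K \<and> (\<forall>L. subfield L A \<and> K \<subseteq> L \<longrightarrow> L = K)"


section \<open>Galois extensions\<close>

text \<open>As in \<^const>\<open>BijGroup\<close>, automorphisms are extensional functions on the carrier, so that
  every automorphism of the field is represented exactly once.\<close>

definition Gal :: "('a, 'r) ring_scheme \<Rightarrow> 'a set \<Rightarrow> ('a \<Rightarrow> 'a) monoid"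
  where "Gal L F = BijGroup (carrier L)
    \<lparr>carrier := {\<sigma> \<in> Bij (carrier L). \<sigma> \<in> ring_hom L L \<and> (\<forall>x \<in> F. \<sigma> x = x)}\<rparr>"

definition fixed_field :: "('a, 'r) ring_scheme \<Rightarrow> ('a \<Rightarrow> 'a) set \<Rightarrow> 'a set"
  where "fixed_field L S = {x \<in> carrier L. \<forall>\<sigma> \<in> S. \<sigma> x = x}"

definition galois_extension :: "('a, 'r) ring_scheme \<Rightarrow> 'a set \<Rightarrow> bool"
  where "galois_extension L F \<longleftrightarrow>
    field L \<and> subfield F L \<and>
    (\<forall>x \<in> carrier L. ((ring.algebraic L) over F) x) \<and>
    fixed_field L (carrier (Gal L F)) = F"


section \<open>Semidirect products\<close>

definition internal_semidirect :: "('a, 'r) monoid_scheme \<Rightarrow> 'a set \<Rightarrow> 'a set \<Rightarrow> bool"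
  where "internal_semidirect G N H \<longleftrightarrow>
    N \<lhd> G \<and> subgroup H G \<and> N \<inter> H = {\<one>\<^bsub>G\<^esub>} \<and> N <#>\<^bsub>G\<^esub> H = carrier G"

definition conjugation :: "('a, 'r) monoid_scheme \<Rightarrow> 'a set \<Rightarrow> 'a \<Rightarrow> 'a \<Rightarrow> 'a"
  where "conjugation G N = (\<lambda>g. \<lambda>x \<in> N. g \<otimes>\<^bsub>G\<^esub> x \<otimes>\<^bsub>G\<^esub> inv\<^bsub>G\<^esub> g)"

text \<open>Restricted to orders \<open>k > 0\<close>, since \<^term>\<open>integer_mod_group 0\<close> is infinite cyclic.\<close>

definition cyclic_subgroup_of_order :: "('a, 'r) monoid_scheme \<Rightarrow> 'a set \<Rightarrow> nat \<Rightarrow> bool"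
  where "cyclic_subgroup_of_order G C k \<longleftrightarrow>
    k > 0 \<and> subgroup C G \<and> G\<lparr>carrier := C\<rparr> \<cong> integer_mod_group k"

end

theory Submission
  imports Defs "HOL-Number_Theory.Residues"
begin

text \<open>
  Write \<open>G = P H\<close> for the Galois group of \<open>E' / F\<close>, with \<open>P\<close> of order \<open>p\<close>. The complement
  \<open>H\<close> may act on \<open>P\<close> with a kernel \<open>N\<close>, the set of elements of \<open>H\<close> commuting with all of \<open>P\<close>.
  Since \<open>N\<close> is normalised by \<open>H\<close> and centralised by \<open>P\<close>, it is normal in \<open>G\<close>, and dividing it out
  is the whole construction: let \<open>E\<close> be the fixed field of \<open>N\<close>. It contains \<open>K\<close>, the fixed
  field of the larger group \<open>H\<close>, and the Galois group of \<open>E / F\<close> is \<open>G / N\<close>, the product of the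
  image of \<open>P\<close>, which is still of order \<open>p\<close> because \<open>P\<close> meets \<open>N\<close> trivially, and of \<open>H / N\<close>.

  The action of \<open>H / N\<close> is faithful: if \<open>h\<close> commutes with \<open>P\<close> modulo \<open>N\<close>, then the commutators of
  \<open>h\<close> with elements of \<open>P\<close> lie both in \<open>P\<close> and in \<open>N\<close>, so they are trivial and \<open>h\<close> is in \<open>N\<close>.
  It remains to see that \<open>H / N\<close> is cyclic. A faithful action by automorphisms on a group of prime
  order \<open>p\<close> embeds it into the group of units of the integers modulo \<open>p\<close>, which is cyclic
  (\<open>cyclic_group_if_conjugation_faithful\<close>).

  The Galois theory needed is that restriction to \<open>E\<close> maps \<open>G\<close> onto the Galois group of \<open>E / F\<close>
  with kernel \<open>N\<close> (\<open>restrict_normal_fixed_field_epi\<close>). Both halves are instances of Artin's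
  theorem, \<open>Gal_mem_if_fixes_fixed_field\<close>: an automorphism that fixes every element fixed by a
  finite group \<open>S\<close> of automorphisms belongs to \<open>S\<close>. For the kernel it is applied to \<open>S = N\<close>; for
  surjectivity, to the group of all restrictions, whose fixed field is \<open>F\<close>. Artin's theorem in turn
  follows from the linear independence of distinct characters.
\<close>


section \<open>Cyclic groups\<close>

text \<open>
  The subgroup is generated by the least positive power of a generator of \<open>G\<close> that it contains,
  by division with remainder of exponents.
\<close>

lemma (in group) cyclic_group_subgroup:
  assumes "cyclic_group G" "subgroup H G"
  shows "cyclic_group (G\<lparr>carrier := H\<rparr>)"
proof -
  obtain x where x: "x \<in> carrier G" and G: "carrier G = range (\<lambda>n::int. x [^] n)"
    using assms(1) cyclic_group by auto
  interpret H: group "G\<lparr>carrier := H\<rparr>"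
    using assms(2) subgroup_imp_group by blast
  have HG: "H \<subseteq> carrier G"
    using assms(2) subgroup.subset by blast
  show ?thesis
  proof (cases "H = {\<one>}")
    case True
    then show ?thesis
      using H.is_group by (intro trivial_imp_cyclic_group) (simp add: trivial_group_def)
  next
    case False
    then obtain y where y: "y \<in> H" "y \<noteq> \<one>"
      using subgroup.one_closed[OF assms(2)] by auto
    then obtain k :: int where k: "y = x [^] k"
      using HG G by auto
    have "k \<noteq> 0"
      using k y by (cases "k = 0") auto
    have "x [^] \<bar>k\<bar> \<in> H"
      using y k x subgroup.m_inv_closed[OF assms(2) y(1)] by (auto simp: abs_if int_pow_neg)
    \<comment> \<open>A positive exponent is available, as \<open>H\<close> contains inverses.\<close>
    then have ex: "0 < nat \<bar>k\<bar> \<and> x [^] int (nat \<bar>k\<bar>) \<in> H"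
      using \<open>k \<noteq> 0\<close> by simp
    define d where "d = (LEAST n. 0 < n \<and> x [^] int n \<in> H)"
    have d: "0 < d" "x [^] int d \<in> H"
      using LeastI[of "\<lambda>n. 0 < n \<and> x [^] int n \<in> H", OF ex] by (auto simp: d_def)
    have least: "d \<le> n" if "0 < n" "x [^] int n \<in> H" for n
      unfolding d_def using that by (intro Least_le) auto
    let ?z = "x [^] int d"
    have pow: "?z [^]\<^bsub>G\<lparr>carrier := H\<rparr>\<^esub> n = ?z [^] n" for n :: int
      using int_pow_consistent[OF assms(2) d(2)] by simp
    have "\<exists>n::int. y = ?z [^] n" if y: "y \<in> H" for y
    proof -
      obtain k :: int where k: "y = x [^] k"
        using y HG G by auto
      define q r where "q = k div int d" and "r = k mod int d"
      have zq: "?z [^] q \<in> H"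
        using H.int_pow_closed[of ?z q] d pow by simp
      have "x [^] k = ?z [^] q \<otimes> x [^] r"
        using x by (simp add: int_pow_pow int_pow_mult[symmetric] q_def r_def)
      then have "x [^] r = inv (?z [^] q) \<otimes> y"
        using x k by (simp add: m_assoc[symmetric])
      then have "x [^] r \<in> H"
        using zq y assms(2) by (simp add: subgroup.m_closed subgroup.m_inv_closed)
      moreover have "0 \<le> r" "r < int d"
        using d by (auto simp: r_def)
      ultimately have "r = 0"
        using least[of "nat r"] by force
      then show ?thesis
        using \<open>x [^] k = ?z [^] q \<otimes> x [^] r\<close> k x by auto
    qed
    moreover have "?z [^] n \<in> H" for n :: int
      using H.int_pow_closed[of ?z n] d pow by simp
    ultimately have "H = range (\<lambda>n::int. ?z [^] n)"
      by auto
    then show ?thesis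
      unfolding H.cyclic_group using d pow by (intro bexI[of _ ?z]) auto
  qed
qed

lemma (in group) cyclic_group_if_embeds:
  assumes "f \<in> mon G M" "group M" "cyclic_group M"
  shows "cyclic_group G"
proof -
  interpret M: group M by fact
  interpret f: group_hom G M f
    using assms by unfold_locales (auto simp: mon_def)
  have "f \<in> iso G (M\<lparr>carrier := f ` carrier G\<rparr>)"
    using assms(1) by (auto simp: mon_def iso_def hom_def bij_betw_def)
  moreover have "group (M\<lparr>carrier := f ` carrier G\<rparr>)"
    using f.img_is_subgroup M.subgroup_imp_group by blast
  moreover have "cyclic_group (M\<lparr>carrier := f ` carrier G\<rparr>)"
    using M.cyclic_group_subgroup[OF assms(3) f.img_is_subgroup] .
  ultimately show ?thesis
    using isomorphic_group_cyclicity[of G] is_group by (auto simp: is_iso_def)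
qed

text \<open>
  If \<open>x\<close> generates \<open>G\<close> then \<open>ord x\<close> is the order of \<open>G\<close>, so powers of \<open>x\<close> agree exactly when
  their exponents are congruent modulo that order.
\<close>
lemma (in group) finite_cyclic_group_iso:
  assumes "finite (carrier G)" "cyclic_group G"
  shows "0 < order G" "G \<cong> integer_mod_group (order G)"
proof -
  show pos: "0 < order G"
    using assms(1) order_gt_0_iff_finite by blast
  obtain x where x: "x \<in> carrier G" and G: "carrier G = range (\<lambda>n::int. x [^] n)"
    using assms(2) cyclic_group by auto
  have "carrier G = generate G {x}"
    using G x generate_pow by auto
  then have ord: "ord x = order G"
    using generate_pow_card[OF x] by (simp add: order_def)
  have eq: "x [^] (m::int) = x [^] n \<longleftrightarrow> m mod int (order G) = n mod int (order G)" for m n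
    using int_pow_eq[OF x] by (simp add: ord mod_eq_dvd_iff dvd_diff_commute)
  let ?Z = "integer_mod_group (order G)"
  have car: "carrier ?Z = {0..<int (order G)}"
    using pos by (simp add: carrier_integer_mod_group)
  have "(\<lambda>n::int. x [^] n) \<in> hom ?Z G"
    using x by (auto simp: hom_def int_pow_mult[symmetric] eq)
  moreover have "inj_on (\<lambda>n::int. x [^] n) (carrier ?Z)"
    by (auto simp: inj_on_def car eq)
  moreover have "x [^] n \<in> (\<lambda>n::int. x [^] n) ` carrier ?Z" for n :: int
    by (rule image_eqI[of _ _ "n mod int (order G)"]) (use pos in \<open>auto simp: car eq\<close>)
  then have "(\<lambda>n::int. x [^] n) ` carrier ?Z = carrier G"
    using G by auto
  ultimately have "(\<lambda>n::int. x [^] n) \<in> iso ?Z G"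
    by (auto simp: iso_def bij_betw_def)
  then show "G \<cong> ?Z"
    using group.iso_sym[OF group_integer_mod_group] by (auto simp: is_iso_def)
qed

section \<open>Faithful actions on a cyclic group of prime order\<close>

text \<open>An endomorphism of a cyclic group is determined by the image of the generator \<open>1\<close>.\<close>
lemma hom_integer_mod_group_eq_mult:
  assumes f: "f \<in> hom (integer_mod_group p) (integer_mod_group p)"
    and p: "1 < p" and n: "n \<in> carrier (integer_mod_group p)"
  shows "f n = (n * f 1) mod int p"
proof -
  have "k < p \<longrightarrow> f (int k) = (int k * f 1) mod int p" for k
  proof (induction k)
    case 0
    have "f 0 = 0"
      using hom_one[OF f] by simp
    then show ?case by simp
  next
    case (Suc k)
    show ?case
    proof
      assume k: "Suc k < p"
      have "f (int k \<otimes>\<^bsub>integer_mod_group p\<^esub> 1) = f (int k) \<otimes>\<^bsub>integer_mod_group p\<^esub> f 1"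
        using k by (intro hom_mult[OF f]) (auto simp: carrier_integer_mod_group)
      then show "f (int (Suc k)) = (int (Suc k) * f 1) mod int p"
        using Suc k by (simp add: mod_simps algebra_simps)
    qed
  qed
  from this[of "nat n"] show ?thesis
    using n p by (auto simp: carrier_integer_mod_group)
qed

text \<open>
  The character \<open>c \<mapsto> \<phi> c 1\<close> is multiplicative because each \<open>\<phi> c\<close> is multiplication by its value
  at \<open>1\<close>, and it is injective because the action is faithful. It therefore embeds the group into the
  multiplicative group of the field with \<open>p\<close> elements, which is cyclic.
\<close>
lemma (in group) cyclic_group_if_acts_faithfully_on_integer_mod_group:
  fixes \<phi> :: "'a \<Rightarrow> int \<Rightarrow> int" and p :: nat
  defines "Z \<equiv> integer_mod_group p"
  assumes p: "Factorial_Ring.prime p"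
    and hom: "\<And>c. c \<in> carrier G \<Longrightarrow> \<phi> c \<in> hom Z Z"
    and one: "\<And>n. n \<in> carrier Z \<Longrightarrow> \<phi> \<one> n = n"
    and mult: "\<And>c d n. \<lbrakk>c \<in> carrier G; d \<in> carrier G; n \<in> carrier Z\<rbrakk> \<Longrightarrow> \<phi> (c \<otimes> d) n = \<phi> c (\<phi> d n)"
    and faithful: "\<And>c. \<lbrakk>c \<in> carrier G; \<And>n. n \<in> carrier Z \<Longrightarrow> \<phi> c n = n\<rbrakk> \<Longrightarrow> c = \<one>"
  shows "cyclic_group G"
proof -
  interpret R: residues_prime p "residue_ring (int p)"
    using p by (simp_all add: residues_prime_def)
  let ?R = "residue_ring (int p)"
  let ?M = "Multiplicative_Group.mult_of ?R"
  have p1: "1 < p"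
    using p prime_gt_1_nat by blast
  have car: "carrier Z = {0..<int p}"
    using p1 by (simp add: Z_def carrier_integer_mod_group)
  have linear: "\<phi> c n = (n * \<phi> c 1) mod int p" if "c \<in> carrier G" "n \<in> carrier Z" for c n
    using hom_integer_mod_group_eq_mult[OF _ p1] hom[OF that(1)] that(2) by (simp add: Z_def)
  define \<chi> where "\<chi> c = \<phi> c 1" for c
  have \<chi>_mem: "\<chi> c \<in> carrier Z" if "c \<in> carrier G" for c
    using hom[OF that] p1 by (auto simp: \<chi>_def hom_def car)
  have \<chi>_mult: "\<chi> (c \<otimes> d) = (\<chi> c * \<chi> d) mod int p" if "c \<in> carrier G" "d \<in> carrier G" for c d
    using that mult[of c d 1] linear[of c "\<phi> d 1"] \<chi>_mem[of d] p1 by (simp add: \<chi>_def car mult.commute)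
  have \<chi>_one: "\<chi> \<one> = 1"
    using one[of 1] p1 by (simp add: \<chi>_def car)
  have \<chi>_nonzero: "\<chi> c \<noteq> 0" if "c \<in> carrier G" for c
    using \<chi>_mult[of c "inv c"] \<chi>_one that by auto
  have carR: "carrier ?R = {0..<int p}" "\<zero>\<^bsub>?R\<^esub> = 0" "(\<otimes>\<^bsub>?R\<^esub>) = (\<lambda>x y. (x * y) mod int p)"
    by (auto simp: residue_ring_def)
  have M: "group ?M"
    using Multiplicative_Group.field.field_mult_group[OF R.field_axioms] .
  have "\<chi> \<in> hom G ?M"
    using \<chi>_mem \<chi>_nonzero \<chi>_mult by (auto simp: hom_def carR car)
  moreover have "inj_on \<chi> (carrier G)"
  proof (rule inj_onI)
    fix c d assume c: "c \<in> carrier G" and d: "d \<in> carrier G" and eq: "\<chi> c = \<chi> d"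
    have "\<chi> (inv d \<otimes> c) = \<chi> (inv d \<otimes> d)"
      using c d eq \<chi>_mult[of "inv d" c] \<chi>_mult[of "inv d" d] by (simp del: l_inv)
    then have "\<chi> (inv d \<otimes> c) = 1"
      using d \<chi>_one by simp
    then have "inv d \<otimes> c = \<one>"
      using c d linear[of "inv d \<otimes> c"] by (intro faithful) (auto simp: \<chi>_def car)
    then show "c = d"
      using c d by (metis inv_equality inv_inv inv_closed)
  qed
  ultimately have "\<chi> \<in> mon G ?M"
    by (simp add: mon_def)
  moreover have "cyclic_group ?M"
  proof -
    have "finite (carrier ?R)"
      by (simp add: carR)
    then obtain a where a: "a \<in> carrier ?M" "carrier ?M = {a [^]\<^bsub>?R\<^esub> i | i::nat. i \<in> UNIV}"
      using R.finite_field_mult_group_has_gen by blast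
    have "carrier ?M \<subseteq> range (\<lambda>n::int. a [^]\<^bsub>?M\<^esub> n)"
    proof
      fix y assume "y \<in> carrier ?M"
      then obtain i :: nat where "y = a [^]\<^bsub>?M\<^esub> i"
        unfolding a(2) Multiplicative_Group.nat_pow_mult_of by auto
      then have "y = a [^]\<^bsub>?M\<^esub> int i"
        by (simp add: int_pow_int)
      then show "y \<in> range (\<lambda>n::int. a [^]\<^bsub>?M\<^esub> n)" by blast
    qed
    then show ?thesis
      using a(1) group.int_pow_closed[OF M a(1)] by (auto simp: group.cyclic_group[OF M] intro!: bexI[of _ a])
  qed
  ultimately show ?thesis
    using cyclic_group_if_embeds M by blast
qed

text \<open>
  Transporting conjugation along an isomorphism of \<open>Q\<close> with the integers modulo \<open>p\<close> reduces this to
  the previous lemma.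
\<close>
lemma (in group) cyclic_group_if_conjugation_faithful:
  assumes p: "Factorial_Ring.prime p" and Q: "Q \<lhd> G" "cyclic_subgroup_of_order G Q p"
    and C: "subgroup C G"
    and faithful: "\<And>c. \<lbrakk>c \<in> C; \<And>q. q \<in> Q \<Longrightarrow> c \<otimes> q = q \<otimes> c\<rbrakk> \<Longrightarrow> c = \<one>"
  shows "cyclic_group (G\<lparr>carrier := C\<rparr>)"
proof -
  let ?Z = "integer_mod_group p"
  interpret Q: normal Q G by fact
  interpret C: group "G\<lparr>carrier := C\<rparr>"
    using C subgroup_imp_group by blast
  have CG: "c \<in> carrier G" if "c \<in> C" for c
    using that C subgroup.subset by blast
  have "G\<lparr>carrier := Q\<rparr> \<cong> ?Z"
    using Q(2) by (simp add: cyclic_subgroup_of_order_def)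
  then have "?Z \<cong> G\<lparr>carrier := Q\<rparr>"
    using Q.subgroup_is_group group.iso_sym is_group by blast
  then obtain f where f: "f \<in> iso ?Z (G\<lparr>carrier := Q\<rparr>)"
    by (auto simp: is_iso_def)
  have bij: "bij_betw f (carrier ?Z) Q"
    using f by (simp add: iso_def)
  have f_mult: "f (m \<otimes>\<^bsub>?Z\<^esub> n) = f m \<otimes> f n" if "m \<in> carrier ?Z" "n \<in> carrier ?Z" for m n
    using f that by (simp add: iso_def hom_def)
  define g where "g = inv_into (carrier ?Z) f"
  have g_mem: "g q \<in> carrier ?Z" and fg: "f (g q) = q" if "q \<in> Q" for q
    using bij that inv_into_into[of q f "carrier ?Z"] f_inv_into_f[of q f "carrier ?Z"]
    by (auto simp: g_def bij_betw_def)
  have f_mem: "f n \<in> Q" and gf: "g (f n) = n" if "n \<in> carrier ?Z" for n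
    using bij that by (auto simp: g_def bij_betw_def)
  have g_mult: "g (q \<otimes> r) = g q \<otimes>\<^bsub>?Z\<^esub> g r" if "q \<in> Q" "r \<in> Q" for q r
    using f_mult[of "g q" "g r"] gf[of "g q \<otimes>\<^bsub>?Z\<^esub> g r"] fg that g_mem
      group.is_monoid[OF group_integer_mod_group, of p] monoid.m_closed[of ?Z "g q" "g r"] by metis
  have conj_mem: "c \<otimes> q \<otimes> inv c \<in> Q" if "c \<in> C" "q \<in> Q" for c q
    using Q.inv_op_closed2 that CG by blast
  have conj_mult: "c \<otimes> (q \<otimes> r) \<otimes> inv c = (c \<otimes> q \<otimes> inv c) \<otimes> (c \<otimes> r \<otimes> inv c)"
    if "c \<in> C" "q \<in> Q" "r \<in> Q" for c q r
  proof -
    have "inv c \<otimes> (c \<otimes> (r \<otimes> inv c)) = r \<otimes> inv c"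
      using that CG Q.subset by (simp add: m_assoc[symmetric] subset_iff)
    then show ?thesis
      using that CG Q.subset by (simp add: m_assoc subset_iff)
  qed
  define \<phi> where "\<phi> c n = g (c \<otimes> f n \<otimes> inv c)" for c n
  show ?thesis
  proof (rule C.cyclic_group_if_acts_faithfully_on_integer_mod_group[OF p, of \<phi>])
    fix c assume c: "c \<in> carrier (G\<lparr>carrier := C\<rparr>)"
    show "\<phi> c \<in> hom ?Z ?Z"
    proof (rule homI)
      fix n assume "n \<in> carrier ?Z"
      then show "\<phi> c n \<in> carrier ?Z"
        unfolding \<phi>_def using c by (intro g_mem conj_mem f_mem) auto
    next
      fix m n assume mn: "m \<in> carrier ?Z" "n \<in> carrier ?Z"
      have "\<phi> c (m \<otimes>\<^bsub>?Z\<^esub> n) = g ((c \<otimes> f m \<otimes> inv c) \<otimes> (c \<otimes> f n \<otimes> inv c))"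
        using conj_mult[of c "f m" "f n"] c mn f_mem f_mult[OF mn] by (simp add: \<phi>_def)
      also have "\<dots> = \<phi> c m \<otimes>\<^bsub>?Z\<^esub> \<phi> c n"
        unfolding \<phi>_def using c mn by (intro g_mult conj_mem f_mem) auto
      finally show "\<phi> c (m \<otimes>\<^bsub>?Z\<^esub> n) = \<phi> c m \<otimes>\<^bsub>?Z\<^esub> \<phi> c n" .
    qed
  next
    fix n assume "n \<in> carrier ?Z"
    then show "\<phi> \<one>\<^bsub>G\<lparr>carrier := C\<rparr>\<^esub> n = n"
      using f_mem[of n] Q.subset gf by (auto simp: \<phi>_def)
  next
    fix c d n assume *: "c \<in> carrier (G\<lparr>carrier := C\<rparr>)" "d \<in> carrier (G\<lparr>carrier := C\<rparr>)" "n \<in> carrier ?Z"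
    then show "\<phi> (c \<otimes>\<^bsub>G\<lparr>carrier := C\<rparr>\<^esub> d) n = \<phi> c (\<phi> d n)"
      using fg[OF conj_mem[of d "f n"]] f_mem[of n] subsetD[OF Q.subset, of "f n"] CG[of c] CG[of d]
      by (simp add: \<phi>_def inv_mult_group m_assoc)
  next
    fix c assume c: "c \<in> carrier (G\<lparr>carrier := C\<rparr>)" and triv: "\<And>n. n \<in> carrier ?Z \<Longrightarrow> \<phi> c n = n"
    have "c \<otimes> q = q \<otimes> c" if q: "q \<in> Q" for q
    proof -
      have "c \<otimes> q \<otimes> inv c = q"
        using triv[OF g_mem[OF q]] fg[OF q] fg[OF conj_mem[of c q]] c q by (simp add: \<phi>_def)
      then show ?thesis
        using c q CG Q.subset by (simp add: inv_solve_right' subset_iff)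
    qed
    then show "c = \<one>\<^bsub>G\<lparr>carrier := C\<rparr>\<^esub>"
      using faithful c by simp
  qed
qed

lemma (in group) faithful_conjugation:
  assumes N: "N \<lhd> G" and C: "subgroup C G"
    and faithful: "\<And>c. \<lbrakk>c \<in> C; \<And>q. q \<in> N \<Longrightarrow> c \<otimes> q = q \<otimes> c\<rbrakk> \<Longrightarrow> c = \<one>"
  shows "faithful_action (G\<lparr>carrier := C\<rparr>) N (conjugation G N)"
proof -
  interpret N: normal N G by fact
  have CG: "c \<in> carrier G" if "c \<in> C" for c
    using that C subgroup.subset by blast
  have NG: "q \<in> carrier G" if "q \<in> N" for q
    using that N.subset by blast
  have conj_mem: "c \<otimes> q \<otimes> inv c \<in> N" if "c \<in> carrier G" "q \<in> N" for c q
    using N.inv_op_closed2 that by blast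
  have comp: "c \<otimes> (d \<otimes> q \<otimes> inv d) \<otimes> inv c = (c \<otimes> d) \<otimes> q \<otimes> inv (c \<otimes> d)"
    if "c \<in> carrier G" "d \<in> carrier G" "q \<in> N" for c d q
    using that NG by (simp add: inv_mult_group m_assoc)
  have Bij: "conjugation G N c \<in> Bij N" if c: "c \<in> carrier G" for c
  proof -
    have "bij_betw (conjugation G N c) N N"
      by (rule bij_betw_byWitness[where f' = "conjugation G N (inv c)"])
        (use c conj_mem[of c] conj_mem[of "inv c"] NG comp[of c "inv c"] comp[of "inv c" c] in \<open>auto simp: conjugation_def\<close>)
    then show ?thesis
      by (simp add: Bij_def conjugation_def)
  qed
  interpret C: group "G\<lparr>carrier := C\<rparr>"
    using C subgroup_imp_group by blast
  have hom: "conjugation G N \<in> hom (G\<lparr>carrier := C\<rparr>) (BijGroup N)"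
  proof (rule homI)
    fix c d assume *: "c \<in> carrier (G\<lparr>carrier := C\<rparr>)" "d \<in> carrier (G\<lparr>carrier := C\<rparr>)"
    then show "conjugation G N (c \<otimes>\<^bsub>G\<lparr>carrier := C\<rparr>\<^esub> d) =
        conjugation G N c \<otimes>\<^bsub>BijGroup N\<^esub> conjugation G N d"
      using Bij CG conj_mem comp by (auto simp: BijGroup_def compose_def conjugation_def fun_eq_iff)
  qed (use Bij CG in \<open>auto simp: BijGroup_def\<close>)
  interpret act: group_hom "G\<lparr>carrier := C\<rparr>" "BijGroup N" "conjugation G N"
    using hom group_BijGroup C.is_group by (simp add: group_hom_def group_hom_axioms_def)
  have "inj_on (conjugation G N) C"
  proof -
    have "c = \<one>" if c: "c \<in> C" and triv: "conjugation G N c = \<one>\<^bsub>BijGroup N\<^esub>" for c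
    proof (rule faithful[OF c])
      fix q assume q: "q \<in> N"
      then have "c \<otimes> q \<otimes> inv c = q"
        using fun_cong[OF triv, of q] by (simp add: conjugation_def BijGroup_def)
      then show "c \<otimes> q = q \<otimes> c"
        using c q CG NG by (metis inv_solve_right m_closed)
    qed
    then show ?thesis
      using act.inj_on_one_iff by auto
  qed
  then show ?thesis
    using act.group_hom_axioms by (auto simp: faithful_action_def group_action_def faithful_action_axioms_def)
qed


section \<open>Quotients of semidirect products\<close>

text \<open>
  The images meet trivially because the kernel lies in \<open>C\<close>: if \<open>h x = h c\<close> with \<open>x\<close> in \<open>P\<close> and \<open>c\<close> in
  \<open>C\<close>, then \<open>x\<close> and \<open>c\<close> differ by an element of the kernel, hence of \<open>C\<close>, so \<open>x\<close> is in \<open>C\<close> as well.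
\<close>
lemma (in group_hom) internal_semidirect_epi_image:
  assumes surj: "h ` carrier G = carrier H"
    and PC: "internal_semidirect G P C" and ker: "kernel G H h \<subseteq> C"
  shows "internal_semidirect H (h ` P) (h ` C)"
proof -
  have P: "P \<lhd> G" and C: "subgroup C G" and int: "P \<inter> C = {\<one>}" and prod: "P <#> C = carrier G"
    using PC by (auto simp: internal_semidirect_def)
  interpret P: normal P G by fact
  interpret C: subgroup C G by fact
  have "h ` P \<lhd> H"
    using P.surj_hom_normal_subgroup[OF group_hom_axioms surj] .
  moreover have "subgroup (h ` C) H"
    using subgroup_img_is_subgroup[OF C] .
  moreover have "h ` P \<inter> h ` C = {\<one>\<^bsub>H\<^esub>}"
  proof -
    have "h x = \<one>\<^bsub>H\<^esub>" if x: "x \<in> P" and c: "c \<in> C" and eq: "h x = h c" for x c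
    proof -
      have "inv c \<otimes> x \<in> kernel G H h"
        using x c eq by (simp add: kernel_def)
      then have "c \<otimes> (inv c \<otimes> x) \<in> C"
        using ker c by auto
      then have "x \<in> C"
        using x c by (simp add: G.m_assoc[symmetric])
      then have "x = \<one>"
        using x int by blast
      then show ?thesis by simp
    qed
    moreover have "\<one>\<^bsub>H\<^esub> \<in> h ` P" "\<one>\<^bsub>H\<^esub> \<in> h ` C"
      by (metis P.one_closed hom_one image_eqI, metis C.one_closed hom_one image_eqI)
    ultimately show ?thesis by blast
  qed
  moreover have "h ` P <#>\<^bsub>H\<^esub> h ` C = h ` (P <#> C)"
    by (force simp: set_mult_def image_iff)
  then have "h ` P <#>\<^bsub>H\<^esub> h ` C = carrier H"
    using prod surj by simp
  ultimately show ?thesis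
    by (simp add: internal_semidirect_def)
qed

lemma (in group_hom) cyclic_subgroup_of_order_inj_image:
  assumes P: "cyclic_subgroup_of_order G P p" and ker: "P \<inter> kernel G H h \<subseteq> {\<one>}"
  shows "cyclic_subgroup_of_order H (h ` P) p"
proof -
  have sub: "subgroup P G" and p: "p > 0" and iso: "G\<lparr>carrier := P\<rparr> \<cong> integer_mod_group p"
    using P by (auto simp: cyclic_subgroup_of_order_def)
  interpret P: subgroup P G by fact
  have "inj_on h P"
  proof (rule inj_onI)
    fix x y assume x: "x \<in> P" and y: "y \<in> P" and eq: "h x = h y"
    then have "inv y \<otimes> x \<in> P \<inter> kernel G H h"
      by (simp add: kernel_def)
    then have "inv y \<otimes> x = \<one>"
      using ker by blast
    then have "y \<otimes> (inv y \<otimes> x) = y"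
      using y by simp
    then show "x = y"
      using x y by (simp add: G.m_assoc[symmetric])
  qed
  then have "h \<in> iso (G\<lparr>carrier := P\<rparr>) (H\<lparr>carrier := h ` P\<rparr>)"
    by (auto simp: iso_def hom_def bij_betw_def)
  then have "H\<lparr>carrier := h ` P\<rparr> \<cong> G\<lparr>carrier := P\<rparr>"
    using P.subgroup_is_group[OF G.is_group] group.iso_sym by (auto simp: is_iso_def)
  then have "H\<lparr>carrier := h ` P\<rparr> \<cong> integer_mod_group p"
    using iso iso_trans by blast
  then show ?thesis
    using p subgroup_img_is_subgroup[OF sub] by (simp add: cyclic_subgroup_of_order_def)
qed

text \<open>
  The kernel of the action of a complement is normal in the whole group as soon as the normal factor
  is abelian: elements of \<open>C\<close> normalise it, and elements of \<open>P\<close> commute with it.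
\<close>
lemma (in group) normal_centralizer_in_complement:
  assumes PC: "internal_semidirect G P C"
    and abelian: "\<And>x y. \<lbrakk>x \<in> P; y \<in> P\<rbrakk> \<Longrightarrow> x \<otimes> y = y \<otimes> x"
  shows "{c \<in> C. \<forall>x\<in>P. c \<otimes> x = x \<otimes> c} \<lhd> G"
proof -
  let ?N = "{c \<in> C. \<forall>x\<in>P. c \<otimes> x = x \<otimes> c}"
  have P: "P \<lhd> G" and C: "subgroup C G" and prod: "P <#> C = carrier G"
    using PC by (auto simp: internal_semidirect_def)
  interpret P: normal P G by fact
  interpret C: subgroup C G by fact
  have N: "c \<in> C" "\<And>x. x \<in> P \<Longrightarrow> c \<otimes> x = x \<otimes> c" if "c \<in> ?N" for c
    using that by auto
  have sub: "subgroup ?N G"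
  proof (rule subgroupI)
    have "\<one> \<in> ?N"
      by auto
    then show "?N \<noteq> {}"
      by blast
  next
    fix c assume c: "c \<in> ?N"
    have "inv c \<otimes> x = x \<otimes> inv c" if x: "x \<in> P" for x
    proof -
      have "inv c \<otimes> x = inv c \<otimes> (x \<otimes> c) \<otimes> inv c"
        using x N(1)[OF c] by (simp add: m_assoc)
      also have "\<dots> = inv c \<otimes> (c \<otimes> x) \<otimes> inv c"
        using N(2)[OF c x] by simp
      also have "\<dots> = x \<otimes> inv c"
        using x N(1)[OF c] by (simp add: m_assoc[symmetric])
      finally show ?thesis .
    qed
    then show "inv c \<in> ?N"
      using N(1)[OF c] C.m_inv_closed by blast
  next
    fix c d assume c: "c \<in> ?N" and d: "d \<in> ?N"
    have "c \<otimes> d \<otimes> x = x \<otimes> (c \<otimes> d)" if x: "x \<in> P" for x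
    proof -
      have "c \<otimes> d \<otimes> x = c \<otimes> (x \<otimes> d)"
        using x N(1)[OF c] N(1)[OF d] N(2)[OF d x] by (simp add: m_assoc)
      also have "\<dots> = c \<otimes> x \<otimes> d"
        using x N(1)[OF c] N(1)[OF d] by (simp add: m_assoc)
      also have "\<dots> = x \<otimes> (c \<otimes> d)"
        using x N(1)[OF c] N(1)[OF d] N(2)[OF c x] by (simp add: m_assoc)
      finally show ?thesis .
    qed
    then show "c \<otimes> d \<in> ?N"
      using N(1)[OF c] N(1)[OF d] C.m_closed by blast
  qed (use C.subset in blast)
  have conj_C: "d \<otimes> c \<otimes> inv d \<in> ?N" if d: "d \<in> C" and c: "c \<in> ?N" for c d
  proof -
    have "d \<otimes> c \<otimes> inv d \<otimes> x = x \<otimes> (d \<otimes> c \<otimes> inv d)" if x: "x \<in> P" for x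
    proof -
      let ?y = "inv d \<otimes> x \<otimes> d"
      have y: "?y \<in> P"
        using P.inv_op_closed1[of d x] d x by simp
      have "d \<otimes> c \<otimes> inv d \<otimes> x = d \<otimes> (c \<otimes> ?y) \<otimes> inv d"
        using x d N(1)[OF c] by (simp add: m_assoc)
      also have "\<dots> = d \<otimes> (?y \<otimes> c) \<otimes> inv d"
        using N(2)[OF c y] by simp
      also have "\<dots> = x \<otimes> (d \<otimes> c \<otimes> inv d)"
        using x d N(1)[OF c] by (simp add: m_assoc[symmetric])
      finally show ?thesis .
    qed
    moreover have "d \<otimes> c \<otimes> inv d \<in> C"
      using d N(1)[OF c] by simp
    ultimately show ?thesis
      by blast
  qed
  have "g \<otimes> c \<otimes> inv g \<in> ?N" if g: "g \<in> carrier G" and c: "c \<in> ?N" for g c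
  proof -
    have "g \<in> P <#> C"
      using g prod by simp
    then obtain x d where x: "x \<in> P" and d: "d \<in> C" and g: "g = x \<otimes> d"
      by (auto simp: set_mult_def)
    let ?c = "d \<otimes> c \<otimes> inv d"
    have c': "?c \<in> ?N"
      using conj_C d c .
    have "g \<otimes> c \<otimes> inv g = x \<otimes> ?c \<otimes> inv x"
      using x d N(1)[OF c] by (simp add: g inv_mult_group m_assoc)
    also have "\<dots> = ?c \<otimes> x \<otimes> inv x"
      using N(2)[OF c' x] by simp
    also have "\<dots> = ?c"
      using x d N(1)[OF c] by (simp add: m_assoc)
    finally have "g \<otimes> c \<otimes> inv g = ?c" .
    then show ?thesis
      using c' by (simp only:)
  qed
  then show ?thesis
    unfolding normal_inv_iff using sub by blast
qed


section \<open>Galois groups\<close>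
lemma carrier_Gal: "carrier (Gal L F) = {\<sigma> \<in> Bij (carrier L). \<sigma> \<in> ring_hom L L \<and> (\<forall>x \<in> F. \<sigma> x = x)}"
  by (simp add: Gal_def)

lemma mult_Gal:
  assumes "\<sigma> \<in> carrier (Gal L F)" "\<tau> \<in> carrier (Gal L F)"
  shows "\<sigma> \<otimes>\<^bsub>Gal L F\<^esub> \<tau> = compose (carrier L) \<sigma> \<tau>"
  using assms by (simp add: Gal_def BijGroup_def)

lemma one_Gal: "\<one>\<^bsub>Gal L F\<^esub> = (\<lambda>x \<in> carrier L. x)"
  by (simp add: Gal_def BijGroup_def)

lemma Gal_closed: "\<sigma> \<in> carrier (Gal L F) \<Longrightarrow> x \<in> carrier L \<Longrightarrow> \<sigma> x \<in> carrier L"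
  using Bij_imp_funcset[of \<sigma> "carrier L"] by (auto simp: carrier_Gal)

lemma Gal_ring_hom: "\<sigma> \<in> carrier (Gal L F) \<Longrightarrow> \<sigma> \<in> ring_hom L L"
  by (simp add: carrier_Gal)

lemma Gal_eqI:
  assumes "\<sigma> \<in> carrier (Gal L F)" "\<tau> \<in> carrier (Gal L F)"
    and "\<And>x. x \<in> carrier L \<Longrightarrow> \<sigma> x = \<tau> x"
  shows "\<sigma> = \<tau>"
  using assms extensionalityI[of \<sigma> "carrier L" \<tau>] by (auto simp: carrier_Gal Bij_def)

lemma (in ring) group_Gal:
  assumes "F \<subseteq> carrier R"
  shows "Group.group (Gal R F)"
proof -
  let ?A = "{\<sigma> \<in> Bij (carrier R). \<sigma> \<in> ring_hom R R \<and> (\<forall>x \<in> F. \<sigma> x = x)}"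
  have "subgroup ?A (BijGroup (carrier R))"
  proof (rule group.subgroupI[OF group_BijGroup])
    have "(\<lambda>x\<in>carrier R. x) \<in> ?A"
      using assms by (auto simp: id_Bij ring_hom_def)
    then show "?A \<noteq> {}" by blast
  next
    fix \<sigma> assume \<sigma>: "\<sigma> \<in> ?A"
    define \<tau> where "\<tau> = (\<lambda>x\<in>carrier R. inv_into (carrier R) \<sigma> x)"
    have bij: "bij_betw \<sigma> (carrier R) (carrier R)"
      using \<sigma> by (simp add: Bij_def)
    have \<tau>\<sigma>: "\<tau> (\<sigma> x) = x" and \<sigma>_mem: "\<sigma> x \<in> carrier R" if "x \<in> carrier R" for x
      using that bij by (auto simp: \<tau>_def bij_betw_def)
    have \<sigma>\<tau>: "\<sigma> (\<tau> x) = x" and \<tau>_mem: "\<tau> x \<in> carrier R" if "x \<in> carrier R" for x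
      using that bij by (auto simp: \<tau>_def bij_betw_def f_inv_into_f inv_into_into)
    have hom: "\<sigma> \<in> ring_hom R R" using \<sigma> by simp
    have "\<tau> \<in> ring_hom R R"
    proof (rule ring_hom_memI)
      fix x y assume xy: "x \<in> carrier R" "y \<in> carrier R"
      then show "\<tau> (x \<otimes> y) = \<tau> x \<otimes> \<tau> y"
        using \<tau>\<sigma>[of "\<tau> x \<otimes> \<tau> y"] \<tau>_mem \<sigma>\<tau> ring_hom_mult[OF hom, of "\<tau> x" "\<tau> y"] by simp
      show "\<tau> (x \<oplus> y) = \<tau> x \<oplus> \<tau> y"
        using xy \<tau>\<sigma>[of "\<tau> x \<oplus> \<tau> y"] \<tau>_mem \<sigma>\<tau> ring_hom_add[OF hom, of "\<tau> x" "\<tau> y"] by simp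
    qed (use \<tau>_mem \<tau>\<sigma>[of \<one>] ring_hom_one[OF hom] in auto)
    moreover have "\<tau> x = x" if "x \<in> F" for x
      using that \<tau>\<sigma>[of x] \<sigma> assms by auto
    ultimately show "inv\<^bsub>BijGroup (carrier R)\<^esub> \<sigma> \<in> ?A"
      using \<sigma> inv_BijGroup[of \<sigma> "carrier R"] restrict_inv_into_Bij[of \<sigma> "carrier R"] by (simp add: \<tau>_def)
  next
    fix \<sigma> \<tau> assume *: "\<sigma> \<in> ?A" "\<tau> \<in> ?A"
    then have "compose (carrier R) \<sigma> \<tau> \<in> ring_hom R R"
      using Bij_imp_funcset[of \<tau> "carrier R"] Bij_imp_funcset[of \<sigma> "carrier R"]
      by (auto simp: ring_hom_def compose_def Pi_iff)
    then show "\<sigma> \<otimes>\<^bsub>BijGroup (carrier R)\<^esub> \<tau> \<in> ?A"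
      using * assms compose_Bij[of \<sigma> "carrier R" \<tau>] by (auto simp: BijGroup_def compose_def)
  qed (auto simp: BijGroup_def)
  then have "Group.group (BijGroup (carrier R)\<lparr>carrier := ?A\<rparr>)"
    using group.subgroup_imp_group[OF group_BijGroup] by blast
  then show ?thesis
    by (simp add: Gal_def)
qed

section \<open>Artin's theorem\<close>

text \<open>
  Dedekind's independence of characters. Given a relation over \<open>insert \<tau> S\<close>, evaluating it at
  \<open>x \<otimes> y\<close> and subtracting \<open>\<tau> y\<close> times its value at \<open>x\<close> eliminates \<open>\<tau>\<close>. This leaves a relation
  over \<open>S\<close> with coefficients \<open>c \<sigma> \<otimes> (\<sigma> y \<ominus> \<tau> y)\<close>, which vanish by induction; choosing \<open>y\<close> with
  \<open>\<sigma> y \<noteq> \<tau> y\<close> gives \<open>c \<sigma> = \<zero>\<close>.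
\<close>
lemma (in field) independence_of_characters:
  fixes S :: "('a \<Rightarrow> 'a) set" and c :: "('a \<Rightarrow> 'a) \<Rightarrow> 'a"
  assumes "finite S"
    and char: "\<And>\<sigma>. \<sigma> \<in> S \<Longrightarrow> \<sigma> \<in> hom R R \<and> \<sigma> \<one> = \<one>"
    and distinct: "\<And>\<sigma> \<tau>. \<lbrakk>\<sigma> \<in> S; \<tau> \<in> S; \<And>x. x \<in> carrier R \<Longrightarrow> \<sigma> x = \<tau> x\<rbrakk> \<Longrightarrow> \<sigma> = \<tau>"
    and c: "\<And>\<sigma>. \<sigma> \<in> S \<Longrightarrow> c \<sigma> \<in> carrier R"
    and rel: "\<And>x. x \<in> carrier R \<Longrightarrow> (\<Oplus>\<sigma>\<in>S. c \<sigma> \<otimes> \<sigma> x) = \<zero>"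
  shows "\<forall>\<sigma>\<in>S. c \<sigma> = \<zero>"
  using assms
proof (induction S arbitrary: c rule: finite_induct)
  case empty
  then show ?case by simp
next
  case (insert \<tau> S)
  have mem: "\<sigma> x \<in> carrier R" if "\<sigma> \<in> insert \<tau> S" "x \<in> carrier R" for \<sigma> x
    using insert.prems(1)[OF that(1)] that(2) by (auto simp: hom_def)
  have mult: "\<sigma> (x \<otimes> y) = \<sigma> x \<otimes> \<sigma> y" if "\<sigma> \<in> insert \<tau> S" "x \<in> carrier R" "y \<in> carrier R" for \<sigma> x y
    using insert.prems(1)[OF that(1)] that by (auto simp: hom_def)
  have c_mem: "c \<sigma> \<in> carrier R" if "\<sigma> \<in> insert \<tau> S" for \<sigma>
    using insert.prems(3)[OF that] .
  have \<tau>c: "c \<tau> \<in> carrier R"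
    using c_mem by simp
  have split: "c \<tau> \<otimes> \<tau> x \<oplus> (\<Oplus>\<sigma>\<in>S. c \<sigma> \<otimes> \<sigma> x) = \<zero>" if x: "x \<in> carrier R" for x
    using insert.prems(4)[OF x] insert.hyps x mem c_mem by (simp add: finsum_insert Pi_iff)
  have "\<forall>\<sigma>\<in>S. c \<sigma> \<otimes> (\<sigma> y \<ominus> \<tau> y) = \<zero>" if y: "y \<in> carrier R" for y
  proof (rule insert.IH[of "\<lambda>\<sigma>. c \<sigma> \<otimes> (\<sigma> y \<ominus> \<tau> y)"])
    fix x assume x: "x \<in> carrier R"
    have "(\<Oplus>\<sigma>\<in>S. c \<sigma> \<otimes> (\<sigma> y \<ominus> \<tau> y) \<otimes> \<sigma> x)
        = (\<Oplus>\<sigma>\<in>S. c \<sigma> \<otimes> \<sigma> (x \<otimes> y) \<oplus> \<ominus> \<tau> y \<otimes> (c \<sigma> \<otimes> \<sigma> x))"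
    proof (rule finsum_cong')
      fix \<sigma> assume "\<sigma> \<in> S"
      then have "c \<sigma> \<in> carrier R" "\<sigma> x \<in> carrier R" "\<sigma> y \<in> carrier R" "\<tau> y \<in> carrier R"
        using mem[of \<sigma>] mem[of \<tau>] c_mem[of \<sigma>] x y by auto
      then show "c \<sigma> \<otimes> (\<sigma> y \<ominus> \<tau> y) \<otimes> \<sigma> x = c \<sigma> \<otimes> \<sigma> (x \<otimes> y) \<oplus> \<ominus> \<tau> y \<otimes> (c \<sigma> \<otimes> \<sigma> x)"
        using mult[of \<sigma> x y] \<open>\<sigma> \<in> S\<close> x y by simp algebra
    qed (use x y mem c_mem in auto)
    also have "\<dots> = (\<Oplus>\<sigma>\<in>S. c \<sigma> \<otimes> \<sigma> (x \<otimes> y)) \<oplus> (\<Oplus>\<sigma>\<in>S. \<ominus> \<tau> y \<otimes> (c \<sigma> \<otimes> \<sigma> x))"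
      using x y mem c_mem by (intro finsum_addf) auto
    also have "(\<Oplus>\<sigma>\<in>S. \<ominus> \<tau> y \<otimes> (c \<sigma> \<otimes> \<sigma> x)) = \<ominus> \<tau> y \<otimes> (\<Oplus>\<sigma>\<in>S. c \<sigma> \<otimes> \<sigma> x)"
      using x y mem c_mem insert.hyps(1) by (intro finsum_rdistr[symmetric]) auto
    also have "(\<Oplus>\<sigma>\<in>S. c \<sigma> \<otimes> \<sigma> (x \<otimes> y)) \<oplus> \<ominus> \<tau> y \<otimes> (\<Oplus>\<sigma>\<in>S. c \<sigma> \<otimes> \<sigma> x) = \<zero>"
    proof -
      define A where "A = (\<Oplus>\<sigma>\<in>S. c \<sigma> \<otimes> \<sigma> (x \<otimes> y))"
      define B where "B = (\<Oplus>\<sigma>\<in>S. c \<sigma> \<otimes> \<sigma> x)"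
      have AB: "A \<in> carrier R" "B \<in> carrier R"
        unfolding A_def B_def using x y mem c_mem by (auto intro!: finsum_closed)
      have t: "\<tau> x \<in> carrier R" "\<tau> y \<in> carrier R"
        using x y mem by auto
      have "B \<oplus> c \<tau> \<otimes> \<tau> x = \<zero>"
        using split[OF x] AB t \<tau>c by (simp add: B_def a_comm)
      then have B: "B = \<ominus> (c \<tau> \<otimes> \<tau> x)"
        using AB t \<tau>c by (simp add: sum_zero_eq_neg)
      have "A \<oplus> c \<tau> \<otimes> (\<tau> x \<otimes> \<tau> y) = \<zero>"
        using split[of "x \<otimes> y"] x y mult[of \<tau> x y] AB t \<tau>c by (simp add: A_def a_comm)
      then have A: "A = \<ominus> (c \<tau> \<otimes> (\<tau> x \<otimes> \<tau> y))"
        using AB t \<tau>c by (simp add: sum_zero_eq_neg)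
      have "A \<oplus> \<ominus> \<tau> y \<otimes> B = \<zero>"
        unfolding A B using t \<tau>c by algebra
      then show ?thesis by (simp add: A_def B_def)
    qed
    finally show "(\<Oplus>\<sigma>\<in>S. c \<sigma> \<otimes> (\<sigma> y \<ominus> \<tau> y) \<otimes> \<sigma> x) = \<zero>" .
  qed (use insert.prems mem y in \<open>auto simp: minus_eq\<close>)
  then have factor: "c \<sigma> = \<zero> \<or> \<sigma> y = \<tau> y" if "\<sigma> \<in> S" "y \<in> carrier R" for \<sigma> y
    using that mem[of \<sigma> y] mem[of \<tau> y] c_mem[of \<sigma>] integral[of "c \<sigma>" "\<sigma> y \<ominus> \<tau> y"] by auto
  have zero: "c \<sigma> = \<zero>" if \<sigma>: "\<sigma> \<in> S" for \<sigma>
  proof (rule ccontr)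
    assume "c \<sigma> \<noteq> \<zero>"
    then have "\<sigma> = \<tau>"
      using factor[OF \<sigma>] insert.prems(2)[of \<sigma> \<tau>] \<sigma> by blast
    then show False
      using \<sigma> insert.hyps by simp
  qed
  \<comment> \<open>With only \<open>\<tau>\<close> left, the relation at \<open>\<one>\<close> is \<open>c \<tau> = \<zero>\<close>.\<close>
  have "(\<Oplus>\<sigma>\<in>S. c \<sigma> \<otimes> \<sigma> \<one>) = (\<Oplus>\<sigma>\<in>S. \<zero>)"
    using zero mem by (intro finsum_cong') auto
  then have "c \<tau> = \<zero>"
    using split[of \<one>] insert.prems(1)[of \<tau>] \<tau>c by simp
  with zero show ?case by auto
qed

text \<open>
  The trace \<open>\<Oplus>\<sigma>\<in>S. \<sigma> x\<close> is fixed by \<open>S\<close>, hence by \<open>\<tau>\<close>, which means that summing over the coset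
  \<open>\<tau> S\<close> and over \<open>S\<close> gives the same result for every \<open>x\<close>. If \<open>\<tau>\<close> were not in \<open>S\<close>, the two
  cosets would be disjoint and this would be a nontrivial linear relation between distinct
  automorphisms.
\<close>
lemma (in field) Gal_mem_if_fixes_fixed_field:
  assumes F: "F \<subseteq> carrier R" and S: "subgroup S (Gal R F)" "finite S"
    and \<tau>: "\<tau> \<in> carrier (Gal R F)" and fixed: "\<And>x. x \<in> fixed_field R S \<Longrightarrow> \<tau> x = x"
  shows "\<tau> \<in> S"
proof (rule ccontr)
  assume "\<tau> \<notin> S"
  let ?G = "Gal R F"
  interpret G: group ?G
    using group_Gal[OF F] .
  have SG: "\<sigma> \<in> carrier ?G" if "\<sigma> \<in> S" for \<sigma>
    using that S(1) subgroup.subset by blast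
  define trace where "trace x = (\<Oplus>\<sigma>\<in>S. \<sigma> x)" for x
  have trace_mem: "trace x \<in> carrier R" if "x \<in> carrier R" for x
    unfolding trace_def using that SG Gal_closed[of _ R F] by (auto intro!: finsum_closed)
  have translate: "(\<Oplus>\<sigma>\<in>(\<lambda>\<sigma>. \<rho> \<otimes>\<^bsub>?G\<^esub> \<sigma>) ` S. \<sigma> x) = \<rho> (trace x)"
    if \<rho>: "\<rho> \<in> carrier ?G" and x: "x \<in> carrier R" for \<rho> x
  proof -
    interpret \<rho>: ring_hom_cring R R \<rho>
      using Gal_ring_hom[OF \<rho>] by unfold_locales
    have "(\<Oplus>\<sigma>\<in>(\<lambda>\<sigma>. \<rho> \<otimes>\<^bsub>?G\<^esub> \<sigma>) ` S. \<sigma> x) = (\<Oplus>\<sigma>\<in>S. (\<rho> \<otimes>\<^bsub>?G\<^esub> \<sigma>) x)"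
      using G.inj_on_cmult[OF \<rho>] SG x \<rho> Gal_closed[of _ R F]
      by (intro finsum_reindex) (auto intro: inj_on_subset)
    also have "\<dots> = (\<Oplus>\<sigma>\<in>S. (\<rho> \<circ> (\<lambda>\<sigma>. \<sigma> x)) \<sigma>)"
      using SG x \<rho> Gal_closed[of _ R F] by (intro finsum_cong') (auto simp: mult_Gal compose_def)
    also have "\<dots> = \<rho> (trace x)"
      unfolding trace_def using SG x Gal_closed[of _ R F] by (intro \<rho>.hom_finsum[symmetric]) auto
    finally show ?thesis .
  qed
  have "trace x \<in> fixed_field R S" if x: "x \<in> carrier R" for x
  proof -
    have "\<rho> (trace x) = trace x" if \<rho>: "\<rho> \<in> S" for \<rho>
    proof -
      have "(\<lambda>\<sigma>. \<rho> \<otimes>\<^bsub>?G\<^esub> \<sigma>) ` S = S"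
      proof (rule endo_inj_surj[OF S(2)])
        show "(\<lambda>\<sigma>. \<rho> \<otimes>\<^bsub>?G\<^esub> \<sigma>) ` S \<subseteq> S"
          using subgroup.m_closed[OF S(1) \<rho>] by auto
        show "inj_on (\<lambda>\<sigma>. \<rho> \<otimes>\<^bsub>?G\<^esub> \<sigma>) S"
          using G.inj_on_cmult[OF SG[OF \<rho>]] subgroup.subset[OF S(1)] by (rule inj_on_subset)
      qed
      then show ?thesis
        using translate[OF SG[OF \<rho>] x] by (simp add: trace_def)
    qed
    then show ?thesis
      using trace_mem[OF x] by (simp add: fixed_field_def)
  qed
  then have \<tau>_trace: "\<tau> (trace x) = trace x" if "x \<in> carrier R" for x
    using fixed that by blast
  let ?T = "(\<lambda>\<sigma>. \<tau> \<otimes>\<^bsub>?G\<^esub> \<sigma>) ` S"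
  have TG: "\<sigma> \<in> carrier ?G" if "\<sigma> \<in> ?T" for \<sigma>
    using that SG \<tau> by auto
  have disjoint: "?T \<inter> S = {}"
  proof -
    have False if \<sigma>: "\<sigma> \<in> S" and "\<tau> \<otimes>\<^bsub>?G\<^esub> \<sigma> \<in> S" for \<sigma>
    proof -
      have "\<tau> = (\<tau> \<otimes>\<^bsub>?G\<^esub> \<sigma>) \<otimes>\<^bsub>?G\<^esub> inv\<^bsub>?G\<^esub> \<sigma>"
        using \<tau> SG[OF \<sigma>] by (simp add: G.m_assoc)
      then show False
        using subgroup.m_closed[OF S(1) that(2) subgroup.m_inv_closed[OF S(1) \<sigma>]] \<open>\<tau> \<notin> S\<close> by simp
    qed
    then show ?thesis by blast
  qed
  \<comment> \<open>Coefficients of the relation: \<open>\<one>\<close> on the coset \<open>\<tau> S\<close> and \<open>\<ominus> \<one>\<close> on \<open>S\<close>.\<close>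
  define c where "c \<sigma> = (if \<sigma> \<in> S then \<ominus> \<one> else \<one>)" for \<sigma> :: "'a \<Rightarrow> 'a"
  have "\<forall>\<sigma>\<in>?T \<union> S. c \<sigma> = \<zero>"
  proof (rule independence_of_characters)
    show "finite (?T \<union> S)"
      using S(2) by simp
    show "\<sigma> \<in> hom R R \<and> \<sigma> \<one> = \<one>" if "\<sigma> \<in> ?T \<union> S" for \<sigma>
    proof -
      have "\<sigma> \<in> ring_hom R R"
        using that SG TG Gal_ring_hom[of \<sigma> R F] by blast
      then show ?thesis
        by (auto simp: ring_hom_def hom_def)
    qed
    show "\<sigma> = \<rho>" if "\<sigma> \<in> ?T \<union> S" "\<rho> \<in> ?T \<union> S" "\<And>x. x \<in> carrier R \<Longrightarrow> \<sigma> x = \<rho> x" for \<sigma> \<rho>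
      using that SG TG Gal_eqI[of \<sigma> R F \<rho>] by blast
    show "c \<sigma> \<in> carrier R" for \<sigma>
      by (simp add: c_def)
    fix x assume x: "x \<in> carrier R"
    have mem: "\<sigma> x \<in> carrier R" if "\<sigma> \<in> ?T \<union> S" for \<sigma>
      using that SG TG Gal_closed[of \<sigma> R F x] x by blast
    have "(\<Oplus>\<sigma>\<in>?T \<union> S. c \<sigma> \<otimes> \<sigma> x) = (\<Oplus>\<sigma>\<in>?T. c \<sigma> \<otimes> \<sigma> x) \<oplus> (\<Oplus>\<sigma>\<in>S. c \<sigma> \<otimes> \<sigma> x)"
      using S(2) disjoint mem by (intro finsum_Un_disjoint) (auto simp: c_def)
    also have "(\<Oplus>\<sigma>\<in>?T. c \<sigma> \<otimes> \<sigma> x) = (\<Oplus>\<sigma>\<in>?T. \<sigma> x)"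
      using disjoint mem by (intro finsum_cong') (auto simp: c_def)
    also have "(\<Oplus>\<sigma>\<in>S. c \<sigma> \<otimes> \<sigma> x) = (\<Oplus>\<sigma>\<in>S. \<ominus> \<one> \<otimes> \<sigma> x)"
      using mem by (intro finsum_cong') (auto simp: c_def)
    also have "\<dots> = \<ominus> \<one> \<otimes> trace x"
      unfolding trace_def using mem S(2) by (intro finsum_rdistr[symmetric]) auto
    also have "(\<Oplus>\<sigma>\<in>?T. \<sigma> x) = trace x"
      using translate[OF \<tau> x] \<tau>_trace[OF x] by simp
    also have "trace x \<oplus> \<ominus> \<one> \<otimes> trace x = \<zero>"
      using trace_mem[OF x] by (simp add: l_minus r_neg)
    finally show "(\<Oplus>\<sigma>\<in>?T \<union> S. c \<sigma> \<otimes> \<sigma> x) = \<zero>" .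
  qed
  moreover have "\<tau> \<in> ?T"
    using subgroup.one_closed[OF S(1)] \<tau> by (auto intro!: image_eqI[of _ _ "\<one>\<^bsub>?G\<^esub>"])
  ultimately have "c \<tau> = \<zero>"
    by blast
  then show False
    using \<open>\<tau> \<notin> S\<close> by (simp add: c_def)
qed

section \<open>Fixed fields of normal subgroups\<close>
lemma (in field) subfield_fixed_field:
  assumes "S \<subseteq> carrier (Gal R F)"
  shows "subfield (fixed_field R S) R"
proof (rule subfieldI')
  have hom: "\<sigma> \<in> ring_hom R R" if "\<sigma> \<in> S" for \<sigma>
    using Gal_ring_hom that assms by blast
  have hom_cring: "ring_hom_cring R R \<sigma>" if "\<sigma> \<in> S" for \<sigma>
    using hom[OF that] by unfold_locales
  show "subring (fixed_field R S) R"
  proof (rule subringI)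
    show "fixed_field R S \<subseteq> carrier R"
      by (auto simp: fixed_field_def)
    show "\<one> \<in> fixed_field R S"
      using ring_hom_one[OF hom] by (simp add: fixed_field_def)
    fix h assume "h \<in> fixed_field R S"
    then have h: "h \<in> carrier R" "\<And>\<sigma>. \<sigma> \<in> S \<Longrightarrow> \<sigma> h = h"
      by (auto simp: fixed_field_def)
    have "\<sigma> (\<ominus> h) = \<ominus> h" if "\<sigma> \<in> S" for \<sigma>
      using ring_hom_cring.hom_a_inv[OF hom_cring[OF that] h(1)] h(2)[OF that] by simp
    then show "\<ominus> h \<in> fixed_field R S"
      using h(1) by (simp add: fixed_field_def)
    fix k assume "k \<in> fixed_field R S"
    then have k: "k \<in> carrier R" "\<And>\<sigma>. \<sigma> \<in> S \<Longrightarrow> \<sigma> k = k"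
      by (auto simp: fixed_field_def)
    have "\<sigma> (h \<otimes> k) = h \<otimes> k" if "\<sigma> \<in> S" for \<sigma>
      using ring_hom_mult[OF hom[OF that] h(1) k(1)] h(2)[OF that] k(2)[OF that] by simp
    then show "h \<otimes> k \<in> fixed_field R S"
      using h(1) k(1) by (simp add: fixed_field_def)
    have "\<sigma> (h \<oplus> k) = h \<oplus> k" if "\<sigma> \<in> S" for \<sigma>
      using ring_hom_add[OF hom[OF that] h(1) k(1)] h(2)[OF that] k(2)[OF that] by simp
    then show "h \<oplus> k \<in> fixed_field R S"
      using h(1) k(1) by (simp add: fixed_field_def)
  qed
  fix k assume k: "k \<in> fixed_field R S - {\<zero>}"
  then have unit: "k \<in> Units R"
    by (simp add: fixed_field_def field_Units)
  have "\<sigma> (inv k) = inv k" if \<sigma>: "\<sigma> \<in> S" for \<sigma>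
  proof -
    interpret \<sigma>: ring_hom_cring R R \<sigma>
      using hom_cring[OF \<sigma>] .
    have "\<sigma> k = k"
      using k \<sigma> by (auto simp: fixed_field_def)
    then have "\<sigma> (inv k) \<otimes> k = \<sigma> (inv k \<otimes> k)"
      using \<sigma>.hom_mult[OF Units_inv_closed[OF unit] Units_closed[OF unit]] by metis
    also have "\<dots> = \<one>"
      using unit by simp
    finally show ?thesis
      using k unit Units_inv_closed by (metis Units_closed \<sigma>.hom_closed comm_inv_char m_comm)
  qed
  then show "inv k \<in> fixed_field R S"
    using unit by (simp add: fixed_field_def)
qed

text \<open>
  Normality of \<open>N\<close> makes \<open>E\<close> stable under the Galois group, so that restriction to \<open>E\<close> is defined.
  Artin's theorem over \<open>L\<close> gives its kernel, and Artin's theorem over \<open>E\<close> its surjectivity.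
\<close>
lemma restrict_normal_fixed_field_epi:
  fixes L (structure)
  assumes L: "galois_extension L F" and fin: "finite (carrier (Gal L F))"
    and N: "N \<lhd> Gal L F"
  defines "E \<equiv> fixed_field L N"
  shows "subfield E L" and "F \<subseteq> E" and "galois_extension (L\<lparr>carrier := E\<rparr>) F"
    and "(\<lambda>\<sigma>. restrict \<sigma> E) \<in> epi (Gal L F) (Gal (L\<lparr>carrier := E\<rparr>) F)"
    and "kernel (Gal L F) (Gal (L\<lparr>carrier := E\<rparr>) F) (\<lambda>\<sigma>. restrict \<sigma> E) = N"
proof -
  let ?G = "Gal L F"
  let ?LE = "L\<lparr>carrier := E\<rparr>"
  interpret L: field L
    using L by (simp add: galois_extension_def)
  have F: "subfield F L" and FL: "F \<subseteq> carrier L"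
    using L subfieldE(3) by (auto simp: galois_extension_def)
  interpret G: group ?G
    using L.group_Gal[OF FL] .
  interpret N: normal N ?G by fact
  have NG: "\<sigma> \<in> carrier ?G" if "\<sigma> \<in> N" for \<sigma>
    using that N.subset by blast
  show E: "subfield E L"
    unfolding E_def using L.subfield_fixed_field N.subset by blast
  have EL: "E \<subseteq> carrier L"
    using E subfieldE(3) by blast
  show FE: "F \<subseteq> E"
    using FL NG by (auto simp: E_def fixed_field_def carrier_Gal)
  interpret LE: field ?LE
    using L.subfield_iff(2)[OF E] .
  interpret GE: group "Gal ?LE F"
    using LE.group_Gal FE by simp
  \<comment> \<open>For \<open>\<rho>\<close> in \<open>N\<close> the conjugate of \<open>\<rho>\<close> by \<open>\<sigma>\<close> fixes \<open>x\<close>, so \<open>\<rho>\<close> fixes \<open>\<sigma> x\<close>.\<close>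
  have stable: "\<sigma> x \<in> E" if \<sigma>: "\<sigma> \<in> carrier ?G" and x: "x \<in> E" for \<sigma> x
  proof -
    have xL: "x \<in> carrier L" using x EL by blast
    have "\<rho> (\<sigma> x) = \<sigma> x" if \<rho>: "\<rho> \<in> N" for \<rho>
    proof -
      define \<rho>' where "\<rho>' = inv\<^bsub>?G\<^esub> \<sigma> \<otimes>\<^bsub>?G\<^esub> \<rho> \<otimes>\<^bsub>?G\<^esub> \<sigma>"
      have \<rho>': "\<rho>' \<in> N"
        unfolding \<rho>'_def using N.inv_op_closed1[OF \<sigma> \<rho>] .
      have "\<rho> \<otimes>\<^bsub>?G\<^esub> \<sigma> = \<sigma> \<otimes>\<^bsub>?G\<^esub> \<rho>'"
        using \<sigma> NG[OF \<rho>] by (simp add: \<rho>'_def G.m_assoc[symmetric])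
      then have "\<rho> (\<sigma> x) = \<sigma> (\<rho>' x)"
        using \<sigma> NG[OF \<rho>] NG[OF \<rho>'] xL by (auto simp: mult_Gal compose_def fun_eq_iff split: if_splits)
      then show ?thesis
        using \<rho>' x by (auto simp: E_def fixed_field_def)
    qed
    then show ?thesis
      using Gal_closed[OF \<sigma> xL] by (simp add: E_def fixed_field_def)
  qed
  have restrict_Gal: "restrict \<sigma> E \<in> carrier (Gal ?LE F)" if \<sigma>: "\<sigma> \<in> carrier ?G" for \<sigma>
  proof -
    have inv: "inv\<^bsub>?G\<^esub> \<sigma> \<in> carrier ?G"
      using \<sigma> by simp
    have "(inv\<^bsub>?G\<^esub> \<sigma>) (\<sigma> x) = x \<and> \<sigma> ((inv\<^bsub>?G\<^esub> \<sigma>) x) = x" if "x \<in> carrier L" for x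
      using that fun_cong[OF G.l_inv[OF \<sigma>], of x] fun_cong[OF G.r_inv[OF \<sigma>], of x] \<sigma> inv
      by (simp add: mult_Gal one_Gal compose_def del: G.l_inv G.r_inv)
    then have "bij_betw \<sigma> E E"
      using EL stable[OF \<sigma>] stable[OF inv] by (intro bij_betw_byWitness[where f' = "inv\<^bsub>?G\<^esub> \<sigma>"]) auto
    then have "restrict \<sigma> E \<in> Bij E"
      by (simp add: Bij_def)
    moreover have "restrict \<sigma> E \<in> ring_hom ?LE ?LE"
      using Gal_ring_hom[OF \<sigma>] stable[OF \<sigma>] EL LE.m_closed LE.add.m_closed LE.one_closed
      by (auto simp: ring_hom_def subset_iff)
    ultimately show ?thesis
      using \<sigma> FE by (auto simp: carrier_Gal)
  qed
  have hom: "(\<lambda>\<sigma>. restrict \<sigma> E) \<in> hom ?G (Gal ?LE F)"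
  proof (rule homI)
    fix \<sigma> \<tau> assume *: "\<sigma> \<in> carrier ?G" "\<tau> \<in> carrier ?G"
    then show "restrict (\<sigma> \<otimes>\<^bsub>?G\<^esub> \<tau>) E = restrict \<sigma> E \<otimes>\<^bsub>Gal ?LE F\<^esub> restrict \<tau> E"
      using restrict_Gal stable EL by (auto simp: mult_Gal compose_def fun_eq_iff)
  qed (rule restrict_Gal)
  interpret res: group_hom ?G "Gal ?LE F" "\<lambda>\<sigma>. restrict \<sigma> E"
    using hom by unfold_locales
  let ?S = "(\<lambda>\<sigma>. restrict \<sigma> E) ` carrier ?G"
  have fixed: "fixed_field ?LE ?S \<subseteq> F"
  proof
    fix x assume "x \<in> fixed_field ?LE ?S"
    then have "x \<in> fixed_field L (carrier ?G)"
      using EL by (auto simp: fixed_field_def)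
    then show "x \<in> F"
      using L by (simp add: galois_extension_def)
  qed
  have "\<tau> \<in> ?S" if \<tau>: "\<tau> \<in> carrier (Gal ?LE F)" for \<tau>
  proof (rule LE.Gal_mem_if_fixes_fixed_field[of F])
    show "\<tau> x = x" if "x \<in> fixed_field ?LE ?S" for x
      using that fixed \<tau> by (auto simp: carrier_Gal)
  qed (use FE res.img_is_subgroup fin \<tau> in auto)
  then show "(\<lambda>\<sigma>. restrict \<sigma> E) \<in> epi ?G (Gal ?LE F)"
    using hom restrict_Gal by (auto simp: epi_def)
  have "subfield F ?LE"
    using LE.subfield_iff(1)[of F] L.subfield_iff(2)[OF F] FE by simp
  moreover have "(LE.algebraic over F) x" if "x \<in> E" for x
    using L that EL L.algebraic_consistent[OF subfieldE(1)[OF E]]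
    by (auto simp: galois_extension_def)
  moreover have "fixed_field ?LE (carrier (Gal ?LE F)) = F"
  proof
    show "fixed_field ?LE (carrier (Gal ?LE F)) \<subseteq> F"
      using fixed restrict_Gal unfolding fixed_field_def by blast
    show "F \<subseteq> fixed_field ?LE (carrier (Gal ?LE F))"
      using FE by (auto simp: fixed_field_def carrier_Gal)
  qed
  ultimately show "galois_extension ?LE F"
    using LE.field_axioms by (simp add: galois_extension_def)
  show "kernel ?G (Gal ?LE F) (\<lambda>\<sigma>. restrict \<sigma> E) = N"
  proof
    show "N \<subseteq> kernel ?G (Gal ?LE F) (\<lambda>\<sigma>. restrict \<sigma> E)"
      using NG by (auto simp: kernel_def one_Gal E_def fixed_field_def fun_eq_iff)
    show "kernel ?G (Gal ?LE F) (\<lambda>\<sigma>. restrict \<sigma> E) \<subseteq> N"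
    proof
      fix \<tau> assume \<tau>: "\<tau> \<in> kernel ?G (Gal ?LE F) (\<lambda>\<sigma>. restrict \<sigma> E)"
      show "\<tau> \<in> N"
      proof (rule L.Gal_mem_if_fixes_fixed_field[OF FL N.subgroup_axioms])
        show "finite N"
          using fin N.subset finite_subset by blast
        show "\<tau> x = x" if "x \<in> fixed_field L N" for x
          using \<tau> that by (auto simp: kernel_def one_Gal E_def dest: fun_cong[of _ _ x])
      qed (use \<tau> in \<open>auto simp: kernel_def\<close>)
    qed
  qed
qed


section \<open>Passing to a faithful action\<close>
theorem proposition1p6:
  fixes A :: "('a, 'r) ring_scheme" and E' :: "('b, 's) ring_scheme"
    and F K :: "'a set" and \<iota> :: "'a \<Rightarrow> 'b" and p :: nat
    and P H :: "('b \<Rightarrow> 'b) set"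
  assumes "Factorial_Ring.prime p"
    and "central_simple_algebra F A" and "has_degree F A p"
    and "maximal_subfield K F A"
    and "\<iota> \<in> ring_hom (A\<lparr>carrier := K\<rparr>) E'"
    and "galois_extension E' (\<iota> ` F)"
    and "finite (carrier (Gal E' (\<iota> ` F)))"
    and "internal_semidirect (Gal E' (\<iota> ` F)) P H"
    and "cyclic_subgroup_of_order (Gal E' (\<iota> ` F)) P p"
    and "fixed_field E' H = \<iota> ` K"
  shows "\<exists>E. subfield E E' \<and> \<iota> ` K \<subseteq> E \<and>
    galois_extension (E'\<lparr>carrier := E\<rparr>) (\<iota> ` F) \<and>
    (\<exists>m Q C. internal_semidirect (Gal (E'\<lparr>carrier := E\<rparr>) (\<iota> ` F)) Q C \<and>
      cyclic_subgroup_of_order (Gal (E'\<lparr>carrier := E\<rparr>) (\<iota> ` F)) Q p \<and>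
      cyclic_subgroup_of_order (Gal (E'\<lparr>carrier := E\<rparr>) (\<iota> ` F)) C m \<and>
      faithful_action ((Gal (E'\<lparr>carrier := E\<rparr>) (\<iota> ` F))\<lparr>carrier := C\<rparr>) Q
        (conjugation (Gal (E'\<lparr>carrier := E\<rparr>) (\<iota> ` F)) Q))"
proof -
  let ?L = E' and ?F = "\<iota> ` F"
  let ?G = "Gal E' ?F"
  have L: "galois_extension ?L ?F" and fin: "finite (carrier ?G)"
    and PH: "internal_semidirect ?G P H" and P: "cyclic_subgroup_of_order ?G P p"
    and K: "fixed_field ?L H = \<iota> ` K"
    using assms by blast+
  interpret L: field ?L
    using L by (simp add: galois_extension_def)
  interpret G: group ?G
    using L subfieldE(3) by (intro L.group_Gal) (auto simp: galois_extension_def)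
  have normal: "P \<lhd> ?G" and H: "subgroup H ?G" and PH_1: "P \<inter> H = {\<one>\<^bsub>?G\<^esub>}"
    using PH by (auto simp: internal_semidirect_def)
  interpret P: normal P ?G by fact
  interpret H: subgroup H ?G by fact
  have abelian: "x \<otimes>\<^bsub>?G\<^esub> y = y \<otimes>\<^bsub>?G\<^esub> x" if "x \<in> P" "y \<in> P" for x y
  proof -
    have GP: "group (?G\<lparr>carrier := P\<rparr>)"
      using P.subgroup_is_group[OF G.is_group] .
    have "?G\<lparr>carrier := P\<rparr> \<cong> integer_mod_group p"
      using P by (simp add: cyclic_subgroup_of_order_def)
    then have "comm_group (?G\<lparr>carrier := P\<rparr>)"
      using comm_group.iso_imp_comm_group[OF abelian_integer_mod_group] group.iso_sym[OF GP]
        group.is_monoid[OF GP] by blast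
    then show ?thesis
      using that comm_groupE(4)[of "?G\<lparr>carrier := P\<rparr>" x y] by simp
  qed
  define N where "N = {h \<in> H. \<forall>x\<in>P. h \<otimes>\<^bsub>?G\<^esub> x = x \<otimes>\<^bsub>?G\<^esub> h}"
  have N: "N \<lhd> ?G" and NH: "N \<subseteq> H"
    using G.normal_centralizer_in_complement[OF PH abelian] by (auto simp: N_def)
  define E where "E = fixed_field ?L N"
  let ?\<Gamma> = "Gal (?L\<lparr>carrier := E\<rparr>) ?F"
  define res where "res \<sigma> = restrict \<sigma> E" for \<sigma> :: "'b \<Rightarrow> 'b"
  note E = restrict_normal_fixed_field_epi[OF L fin N, folded E_def, folded res_def]
  have KE: "\<iota> ` K \<subseteq> E"
    using NH by (auto simp: K[symmetric] E_def fixed_field_def)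
  interpret E: field "?L\<lparr>carrier := E\<rparr>"
    using L.subfield_iff(2)[OF E(1)] .
  interpret \<Gamma>: group ?\<Gamma>
    using E.group_Gal E(2) by simp
  interpret res: group_hom ?G ?\<Gamma> res
    using E(4) by unfold_locales (simp add: epi_def)
  have surj: "res ` carrier ?G = carrier ?\<Gamma>" and ker: "kernel ?G ?\<Gamma> res = N"
    using E(4,5) by (auto simp: epi_def)
  have semi: "internal_semidirect ?\<Gamma> (res ` P) (res ` H)"
    using res.internal_semidirect_epi_image[OF surj PH] ker NH by simp
  have Q: "cyclic_subgroup_of_order ?\<Gamma> (res ` P) p"
    using res.cyclic_subgroup_of_order_inj_image[OF P] ker NH PH_1 by blast
  have normal_Q: "res ` P \<lhd> ?\<Gamma>" and sub_C: "subgroup (res ` H) ?\<Gamma>"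
    using semi by (auto simp: internal_semidirect_def)
  have faithful: "c = \<one>\<^bsub>?\<Gamma>\<^esub>"
    if c: "c \<in> res ` H" and comm: "\<And>q. q \<in> res ` P \<Longrightarrow> c \<otimes>\<^bsub>?\<Gamma>\<^esub> q = q \<otimes>\<^bsub>?\<Gamma>\<^esub> c" for c
  proof -
    obtain h where h: "h \<in> H" and c_eq: "c = res h"
      using c by blast
    have "h \<otimes>\<^bsub>?G\<^esub> x = x \<otimes>\<^bsub>?G\<^esub> h" if x: "x \<in> P" for x
    proof -
      \<comment> \<open>The commutator lies in \<open>P\<close> by normality, and in \<open>N\<close>, hence in \<open>H\<close>, since it dies in \<open>?\<Gamma>\<close>.\<close>
      let ?k = "h \<otimes>\<^bsub>?G\<^esub> x \<otimes>\<^bsub>?G\<^esub> inv\<^bsub>?G\<^esub> h \<otimes>\<^bsub>?G\<^esub> inv\<^bsub>?G\<^esub> x"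
      have "h \<otimes>\<^bsub>?G\<^esub> x \<otimes>\<^bsub>?G\<^esub> inv\<^bsub>?G\<^esub> h \<in> P"
        using P.inv_op_closed2[of h x] h x by simp
      then have "?k \<in> P"
        using x by simp
      moreover have "res ?k = \<one>\<^bsub>?\<Gamma>\<^esub>"
      proof -
        have "res h \<otimes>\<^bsub>?\<Gamma>\<^esub> res x = res x \<otimes>\<^bsub>?\<Gamma>\<^esub> res h"
          using comm[of "res x"] x c_eq by simp
        then show ?thesis
          using h x by (simp add: \<Gamma>.m_assoc)
      qed
      then have "?k \<in> H"
        using h x ker NH by (auto simp: kernel_def)
      ultimately have "?k = \<one>\<^bsub>?G\<^esub>"
        using PH_1 by blast
      then show ?thesis
        using h x by (simp add: G.inv_solve_right')
    qed
    then have "h \<in> kernel ?G ?\<Gamma> res"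
      using h ker by (simp add: N_def)
    then show ?thesis
      by (simp add: c_eq kernel_def)
  qed
  interpret C: group "?\<Gamma>\<lparr>carrier := res ` H\<rparr>"
    using \<Gamma>.subgroup_imp_group[OF sub_C] .
  have "cyclic_group (?\<Gamma>\<lparr>carrier := res ` H\<rparr>)"
    using \<Gamma>.cyclic_group_if_conjugation_faithful[OF assms(1) normal_Q Q sub_C faithful] by blast
  moreover have "finite (res ` H)"
    using fin H.subset finite_subset by blast
  ultimately have "cyclic_subgroup_of_order ?\<Gamma> (res ` H) (order (?\<Gamma>\<lparr>carrier := res ` H\<rparr>))"
    using C.finite_cyclic_group_iso sub_C by (simp add: cyclic_subgroup_of_order_def)
  moreover have "faithful_action (?\<Gamma>\<lparr>carrier := res ` H\<rparr>) (res ` P) (conjugation ?\<Gamma> (res ` P))"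
    using \<Gamma>.faithful_conjugation[OF normal_Q sub_C faithful] by blast
  ultimately show ?thesis
    using E(1,3) KE semi Q by blast
qed

end
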